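(* Let $(\mathcal{A},\cdot)$ be a left (resp. right) Zinbiel superalgebra over a field $\mathbb{K}$. If $\mathcal{A}$ is quadratic, then $\mathcal{A}$ is $2$-step nilpotent.
   Context: A superalgebra is a finite-dimensional $\mathbb{Z}_2$-graded vector space $\mathcal{A}=\mathcal{A}_{\bar 0}\oplus\mathcal{A}_{\bar 1}$ over $\mathbb{K}$ with a bilinear product satisfying $\mathcal{A}_i\mathcal{A}_j\subset\mathcal{A}_{i+j}$; $|x|$ is the degree of a homogeneous element $x$. $\mathcal{A}$ is left Zinbiel if $(xy)z=x(yz)+(-1)^{|y||z|}x(zy)$ for all homogeneous $x,y,z$, and right Zinbiel if $x(yz)=(xy)z+(-1)^{|x||y|}(yx)z$ for all homogeneous $x,y,z$. A left (or right) Zinbiel superalgebra $\mathcal{A}$ is quadratic if it is endowed with a non-degenerate bilinear form $\mathfrak{B}:\mathcal{A}\times\mathcal{A}\to\mathbb{K}$ that is supersymmetric ($\mathfrak{B}(x,y)=(-1)^{|x||y|}\mathfrak{B}(y,x)$ for homogeneous $x,y$), invariant ($\mathfrak{B}(xy,z)=\mathfrak{B}(x,yz)$ for all $x,y,z$), and even ($\mathfrak{B}(\mathcal{A}_{\bar 0},\mathcal{A}_{\bar 1})=\mathfrak{B}(\mathcal{A}_{\bar 1},\mathcal{A}_{\bar 0})=\{0\}$). A superalgebra $\mathcal{A}$ is $2$-step nilpotent if $(xy)z=x(yz)=0$ for all homogeneous $x,y,z\in\mathcal{A}$, but the product of the algebra is nonzero.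
   Formalization: The field is assumed to have characteristic other than 2 (the claim fails over every field of characteristic 2, in dimension 8), and the product of the algebra is assumed nonzero (a zero product is quadratic but not 2-step nilpotent as defined). *)

theory Defs
  imports Complex_Main "HOL-Library.Z2"
begin

text \<open>
  The underlying vector space is the whole type \<open>'a\<close>, with scalar multiplication \<open>scale\<close>;
  degrees are elements of \<open>bit\<close>, the field with two elements, and \<open>\<A> i\<close> is the homogeneous
  component of degree \<open>i\<close>. The vector \<open>0\<close> lies in both components, so statements about
  homogeneous elements quantify over a degree together with an element of that component.
\<close>

locale superalgebra = vector_space scale
  for scale :: "'k::field \<Rightarrow> 'a::ab_group_add \<Rightarrow> 'a" +
  fixes mult :: "'a \<Rightarrow> 'a \<Rightarrow> 'a" (infixl \<open>\<cdot>\<close> 70)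
    and \<A> :: "bit \<Rightarrow> 'a set"
  assumes finite_dim: "\<exists>S. finite S \<and> span S = UNIV"
    and subspace_comp: "subspace (\<A> i)"
    and comp_Int: "\<A> 0 \<inter> \<A> 1 = {0}"
    and comp_sum: "\<exists>a\<in>\<A> 0. \<exists>b\<in>\<A> 1. x = a + b"
    and linear_mult_left: "Vector_Spaces.linear scale scale (\<lambda>x. x \<cdot> y)"
    and linear_mult_right: "Vector_Spaces.linear scale scale (\<lambda>y. x \<cdot> y)"
    and mult_comp: "x \<in> \<A> i \<Longrightarrow> y \<in> \<A> j \<Longrightarrow> x \<cdot> y \<in> \<A> (i + j)"

text \<open>\<open>super_sign i j\<close> is $(-1)^{ij}$.\<close>

definition super_sign :: "bit \<Rightarrow> bit \<Rightarrow> 'k::field" where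
  "super_sign i j = (if i * j = 1 then - 1 else 1)"

locale left_zinbiel_superalgebra = superalgebra +
  assumes left_zinbiel:
    "x \<in> \<A> i \<Longrightarrow> y \<in> \<A> j \<Longrightarrow> z \<in> \<A> k \<Longrightarrow>
      (x \<cdot> y) \<cdot> z = x \<cdot> (y \<cdot> z) + scale (super_sign j k) (x \<cdot> (z \<cdot> y))"

locale right_zinbiel_superalgebra = superalgebra +
  assumes right_zinbiel:
    "x \<in> \<A> i \<Longrightarrow> y \<in> \<A> j \<Longrightarrow> z \<in> \<A> k \<Longrightarrow>
      x \<cdot> (y \<cdot> z) = (x \<cdot> y) \<cdot> z + scale (super_sign i j) ((y \<cdot> x) \<cdot> z)"

context superalgebra
begin

definition bilinear_form :: "('a \<Rightarrow> 'a \<Rightarrow> 'k) \<Rightarrow> bool" where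
  "bilinear_form B \<longleftrightarrow>
    (\<forall>y. Vector_Spaces.linear scale (*) (\<lambda>x. B x y)) \<and>
    (\<forall>x. Vector_Spaces.linear scale (*) (\<lambda>y. B x y))"

definition nondegenerate_form :: "('a \<Rightarrow> 'a \<Rightarrow> 'k) \<Rightarrow> bool" where
  "nondegenerate_form B \<longleftrightarrow>
    (\<forall>x. (\<forall>y. B x y = 0) \<longrightarrow> x = 0) \<and> (\<forall>y. (\<forall>x. B x y = 0) \<longrightarrow> y = 0)"

definition supersymmetric_form :: "('a \<Rightarrow> 'a \<Rightarrow> 'k) \<Rightarrow> bool" where
  "supersymmetric_form B \<longleftrightarrow>
    (\<forall>i j. \<forall>x\<in>\<A> i. \<forall>y\<in>\<A> j. B x y = super_sign i j * B y x)"

definition invariant_form :: "('a \<Rightarrow> 'a \<Rightarrow> 'k) \<Rightarrow> bool" where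
  "invariant_form B \<longleftrightarrow> (\<forall>x y z. B (x \<cdot> y) z = B x (y \<cdot> z))"

definition even_form :: "('a \<Rightarrow> 'a \<Rightarrow> 'k) \<Rightarrow> bool" where
  "even_form B \<longleftrightarrow> (\<forall>x\<in>\<A> 0. \<forall>y\<in>\<A> 1. B x y = 0 \<and> B y x = 0)"

definition quadratic :: bool where
  "quadratic \<longleftrightarrow>
    (\<exists>B. bilinear_form B \<and> nondegenerate_form B \<and> supersymmetric_form B \<and>
      invariant_form B \<and> even_form B)"

definition two_step_nilpotent :: bool where
  "two_step_nilpotent \<longleftrightarrow>
    (\<forall>i j k. \<forall>x\<in>\<A> i. \<forall>y\<in>\<A> j. \<forall>z\<in>\<A> k. (x \<cdot> y) \<cdot> z = 0 \<and> x \<cdot> (y \<cdot> z) = 0) \<and>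
    (\<exists>x y. x \<cdot> y \<noteq> 0)"

end

end

theory Submission
  imports Defs
begin

text \<open>
  Moving factors across an invariant non-degenerate form turns the left Zinbiel identity into the
  right one and conversely, so both hold. The left identity gives $(xy)z = \pm (xz)y$, and
  subtracting the two gives $(xy)z = \mp y(zx)$. Together with supersymmetry, and up to Koszul
  signs that cancel,
  $B(xy,zt) = -B(y,(zx)t) = -B((zx)t,y) = -B((zt)x,y) = -B(zt,xy) = -B(xy,zt)$,
  so $(xy)z = 0$ when $2$ is invertible, and then $y(zx) = 0$ as well.
\<close>

locale superalgebra_invariant_form = superalgebra +
  fixes B
  assumes bilinear: "bilinear_form B"
    and nondegenerate: "nondegenerate_form B"
    and invariant: "invariant_form B"
begin

lemma form_add_left: "B (x + y) z = B x z + B y z"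
  and form_scale_left: "B (scale c x) z = c * B x z"
  and form_add_right: "B z (x + y) = B z x + B z y"
  and form_scale_right: "B z (scale c x) = c * B z x"
  using bilinear unfolding bilinear_form_def Vector_Spaces.linear_iff by blast+

lemma form_assoc: "B (x \<cdot> y) z = B x (y \<cdot> z)"
  using invariant by (auto simp: invariant_form_def)

text \<open>The Zinbiel identities are available for homogeneous elements only, so equality is
  tested against homogeneous \<open>t\<close>. This suffices because the two components together
  span the space and \<open>B\<close> is additive and non-degenerate.\<close>

lemma eq_if_form_left_eq:
  assumes "\<And>l t. t \<in> \<A> l \<Longrightarrow> B x t = B y t"
  shows "x = y"
proof -
  \<comment> \<open>The difference is written with \<open>scale (- 1)\<close> so that additivity and
    homogeneity of \<open>B\<close> apply directly; \<open>scale_minus_left\<close> would rewrite it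
    away.\<close>
  have "B (x + scale (- 1) y) t = 0" for t
  proof -
    obtain a b where "a \<in> \<A> 0" "b \<in> \<A> 1" "t = a + b"
      using comp_sum by blast
    then show ?thesis
      using assms[of a 0] assms[of b 1]
      by (simp add: form_add_left form_scale_left form_add_right del: scale_minus_left)
  qed
  then have "x + scale (- 1) y = 0"
    using nondegenerate unfolding nondegenerate_form_def by blast
  then show ?thesis by simp
qed

lemma eq_if_form_right_eq:
  assumes "\<And>l t. t \<in> \<A> l \<Longrightarrow> B t x = B t y"
  shows "x = y"
proof -
  have "B t (x + scale (- 1) y) = 0" for t
  proof -
    obtain a b where "a \<in> \<A> 0" "b \<in> \<A> 1" "t = a + b"
      using comp_sum by blast
    then show ?thesis
      using assms[of a 0] assms[of b 1]
      by (simp add: form_add_left form_scale_right form_add_right del: scale_minus_left)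
  qed
  then have "x + scale (- 1) y = 0"
    using nondegenerate unfolding nondegenerate_form_def by blast
  then show ?thesis by simp
qed

text \<open>Invariance turns \<open>x \<cdot> (y \<cdot> z)\<close> tested by \<open>t\<close> into
  \<open>(t \<cdot> x) \<cdot> y\<close> tested by \<open>z\<close>. The sign in the left identity
  for \<open>t\<close>, \<open>x\<close>, \<open>y\<close> involves only the degrees of
  \<open>x\<close> and \<open>y\<close>, exactly as the right identity requires.\<close>

lemma left_zinbiel_imp_right_zinbiel:
  assumes "left_zinbiel_superalgebra scale mult \<A>"
  shows "right_zinbiel_superalgebra scale mult \<A>"
proof
  fix x y z i j k
  assume xyz: "x \<in> \<A> i" "y \<in> \<A> j" "z \<in> \<A> k"
  show "x \<cdot> (y \<cdot> z) = (x \<cdot> y) \<cdot> z + scale (super_sign i j) ((y \<cdot> x) \<cdot> z)"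
  proof (rule eq_if_form_right_eq)
    fix l t
    assume "t \<in> \<A> l"
    have "B t (x \<cdot> (y \<cdot> z)) = B ((t \<cdot> x) \<cdot> y) z"
      by (simp add: form_assoc)
    also have "\<dots> = B (t \<cdot> (x \<cdot> y) + scale (super_sign i j) (t \<cdot> (y \<cdot> x))) z"
      using left_zinbiel_superalgebra.left_zinbiel[OF assms \<open>t \<in> \<A> l\<close> xyz(1,2)] by simp
    also have "\<dots> = B t ((x \<cdot> y) \<cdot> z + scale (super_sign i j) ((y \<cdot> x) \<cdot> z))"
      by (simp add: form_add_left form_scale_left form_add_right form_scale_right form_assoc[of t])
    finally show "B t (x \<cdot> (y \<cdot> z)) = B t ((x \<cdot> y) \<cdot> z + scale (super_sign i j) ((y \<cdot> x) \<cdot> z))" .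
  qed
qed

text \<open>The mirror image: the test vector \<open>t\<close> enters on the right, and the right
  identity is applied to \<open>y\<close>, \<open>z\<close>, \<open>t\<close>.\<close>

lemma right_zinbiel_imp_left_zinbiel:
  assumes "right_zinbiel_superalgebra scale mult \<A>"
  shows "left_zinbiel_superalgebra scale mult \<A>"
proof
  fix x y z i j k
  assume xyz: "x \<in> \<A> i" "y \<in> \<A> j" "z \<in> \<A> k"
  show "(x \<cdot> y) \<cdot> z = x \<cdot> (y \<cdot> z) + scale (super_sign j k) (x \<cdot> (z \<cdot> y))"
  proof (rule eq_if_form_left_eq)
    fix l t
    assume "t \<in> \<A> l"
    have "B ((x \<cdot> y) \<cdot> z) t = B x (y \<cdot> (z \<cdot> t))"
      by (simp add: form_assoc)
    also have "\<dots> = B x ((y \<cdot> z) \<cdot> t + scale (super_sign j k) ((z \<cdot> y) \<cdot> t))"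
      using right_zinbiel_superalgebra.right_zinbiel[OF assms xyz(2,3) \<open>t \<in> \<A> l\<close>] by simp
    also have "\<dots> = B (x \<cdot> (y \<cdot> z) + scale (super_sign j k) (x \<cdot> (z \<cdot> y))) t"
      by (simp add: form_add_left form_scale_left form_add_right form_scale_right form_assoc[of x])
    finally show "B ((x \<cdot> y) \<cdot> z) t = B (x \<cdot> (y \<cdot> z) + scale (super_sign j k) (x \<cdot> (z \<cdot> y))) t" .
  qed
qed

end

lemma super_sign_commute: "super_sign i j = super_sign j i"
  by (simp add: super_sign_def mult.commute)

lemma super_sign_square [simp]: "super_sign i j * super_sign i j = 1"
  by (simp add: super_sign_def)

text \<open>Exchanging \<open>y\<close> and \<open>z\<close> in the left identity permutes the two
  terms on its right-hand side up to a sign whose square is 1.\<close>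

lemma (in left_zinbiel_superalgebra) mult_mult_swap:
  assumes "x \<in> \<A> i" "y \<in> \<A> j" "z \<in> \<A> k"
  shows "(x \<cdot> y) \<cdot> z = scale (super_sign j k) ((x \<cdot> z) \<cdot> y)"
  using left_zinbiel[OF assms] left_zinbiel[OF assms(1,3,2)]
  by (simp add: scale_right_distrib add.commute super_sign_commute[of k j])

lemma (in superalgebra) left_right_zinbiel_rotate:
  assumes "left_zinbiel_superalgebra scale mult \<A>" "right_zinbiel_superalgebra scale mult \<A>"
    and "x \<in> \<A> i" "y \<in> \<A> j" "z \<in> \<A> k"
  shows "(x \<cdot> y) \<cdot> z = scale (- (super_sign i j * super_sign i k)) (y \<cdot> (z \<cdot> x))"
proof -
  \<comment> \<open>Both identities are taken at the triple \<open>y\<close>, \<open>x\<close>,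
    \<open>z\<close>; adding them cancels \<open>(y \<cdot> x) \<cdot> z\<close> and
    \<open>y \<cdot> (x \<cdot> z)\<close>.\<close>
  have "scale (super_sign j i) ((x \<cdot> y) \<cdot> z) = - scale (super_sign i k) (y \<cdot> (z \<cdot> x))"
    using left_zinbiel_superalgebra.left_zinbiel[OF assms(1) assms(4,3,5)]
      right_zinbiel_superalgebra.right_zinbiel[OF assms(2) assms(4,3,5)]
    by (simp add: eq_neg_iff_add_eq_0)
  then have "scale (super_sign j i) (scale (super_sign j i) ((x \<cdot> y) \<cdot> z)) =
      scale (super_sign j i) (- scale (super_sign i k) (y \<cdot> (z \<cdot> x)))"
    by simp
  then show ?thesis
    by (simp add: super_sign_commute[of j i])
qed

text \<open>The zero product can carry a quadratic structure, while 2-step nilpotency demands a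
  nonzero product; hence \<open>product_nonzero\<close>.\<close>

theorem proposition28:
  fixes scale :: "'k::field \<Rightarrow> 'a::ab_group_add \<Rightarrow> 'a"
    and mult :: "'a \<Rightarrow> 'a \<Rightarrow> 'a"
    and \<A> :: "bit \<Rightarrow> 'a set"
  assumes zinbiel: "left_zinbiel_superalgebra scale mult \<A> \<or> right_zinbiel_superalgebra scale mult \<A>"
    and quadratic: "superalgebra.quadratic scale mult \<A>"
    and char_not_2: "(2::'k) \<noteq> 0"
    and product_nonzero: "\<exists>x y. mult x y \<noteq> 0"
  shows "superalgebra.two_step_nilpotent mult \<A>"
proof -
  have "superalgebra scale mult \<A>"
    using zinbiel left_zinbiel_superalgebra.axioms(1) right_zinbiel_superalgebra.axioms(1) by blast
  then interpret superalgebra scale mult \<A> .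
  obtain B where B: "bilinear_form B" "nondegenerate_form B" "supersymmetric_form B"
      "invariant_form B"
    using quadratic unfolding quadratic_def by blast
  interpret superalgebra_invariant_form scale mult \<A> B
    using B by unfold_locales
  have left: "left_zinbiel_superalgebra scale mult \<A>"
    and right: "right_zinbiel_superalgebra scale mult \<A>"
    using zinbiel left_zinbiel_imp_right_zinbiel right_zinbiel_imp_left_zinbiel by blast+
  interpret left_zinbiel_superalgebra scale mult \<A>
    by (fact left)
  note rotate = left_right_zinbiel_rotate[OF left right]
  have sym: "B x y = super_sign i j * B y x" if "x \<in> \<A> i" "y \<in> \<A> j" for x y i j
    using B(3) that unfolding supersymmetric_form_def by blast
  have left_zero: "mult (mult x y) z = 0"
    if xyz: "x \<in> \<A> i" "y \<in> \<A> j" "z \<in> \<A> k" for x y z i j k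
  proof -
    have "B (mult (mult x y) z) t = B 0 t" if t: "t \<in> \<A> l" for t l
    proof -
      let ?F = "B (mult (mult x y) z) t"
      have "?F = - (super_sign i j * super_sign i k) * B y (mult (mult z x) t)"
        by (simp only: rotate[OF xyz] form_scale_left form_assoc)
      also have "B y (mult (mult z x) t) = super_sign j (k + i + l) * B (mult (mult z x) t) y"
        using xyz t by (intro sym mult_comp)
      \<comment> \<open>After the swap of \<open>x\<close> and \<open>t\<close>, invariance is used
        only at the left factor \<open>mult z t\<close>, which keeps that product intact for the
        next use of symmetry.\<close>
      also have "B (mult (mult z x) t) y = super_sign i l * B (mult z t) (mult x y)"
        by (simp only: mult_mult_swap[OF xyz(3,1) t] form_scale_left form_assoc[of "mult z t"])
      also have "B (mult z t) (mult x y) = super_sign (k + l) (i + j) * B (mult x y) (mult z t)"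
        using xyz t by (intro sym mult_comp)
      also have "B (mult x y) (mult z t) = ?F"
        by (simp only: form_assoc[of "mult x y"])
      \<comment> \<open>In the total exponent of -1 each of the products ij, ik, jk, il, jl occurs
        twice, so only the minus sign from \<open>rotate\<close> survives.\<close>
      finally have "?F = - ?F"
        by (cases i; cases j; cases k; cases l) (simp_all add: super_sign_def)
      then have "2 * ?F = 0"
        by (simp only: mult_2 eq_neg_iff_add_eq_0)
      with char_not_2 have "?F = 0"
        by simp
      then show ?thesis
        \<comment> \<open>Scaling the zero vector by 0 yields \<open>B 0 t = 0\<close>.\<close>
        using form_scale_left[of 0 0 t] by simp
    qed
    then show ?thesis
      by (rule eq_if_form_left_eq)
  qed
  have right_zero: "mult x (mult y z) = 0"
    if xyz: "x \<in> \<A> i" "y \<in> \<A> j" "z \<in> \<A> k" for x y z i j k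
    \<comment> \<open>At the triple \<open>z\<close>, \<open>x\<close>, \<open>y\<close> the
      rotation expresses \<open>mult (mult z x) y\<close>, which is zero, as a unit times
      \<open>mult x (mult y z)\<close>.\<close>
    using rotate[OF xyz(3,1,2)] left_zero[OF xyz(3,1,2)]
    by (auto simp: super_sign_def split: if_splits)
  show ?thesis
    unfolding two_step_nilpotent_def using left_zero right_zero product_nonzero by blast
qed

end
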